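(* For $n\ge1$ let $y_n$ be the number of rows with value $0$ in the truth tables of all bracketed m-implications with $n$ distinct variables, and let $C_n=\frac1n\binom{2n-2}{n-1}$. Then for every $n\ge1$, $y_n\equiv C_n \pmod 2$.
   Context: Truth values are $1$ (true), $0$ (false). The connective $\rightharpoonup$ satisfies $\nu(\phi\rightharpoonup\psi)=0$ iff $\nu(\phi)=\nu(\psi)=1$, and $=1$ otherwise. A bracketed m-implication with $n$ variables is a well-formed formula obtained from $p_1\rightharpoonup\cdots\rightharpoonup p_n$ ($p_i$ distinct variables, in this order) by inserting brackets. $y_n$ is the total, over all such formulae $\phi$, of the number of valuations $\nu$ of $p_1,\dots,p_n$ with $\nu(\phi)=0$. (The paper phrases the conclusion as "the sequence $y_n$ preserves the parity of $C_n$", and in particular $y_n$ is odd iff $n$ is a power of $2$.) *)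

theory Defs
  imports "HOL-Library.FuncSet" "HOL-Number_Theory.Cong"
begin

text \<open>Variable \<open>p\<^sub>i\<close> is \<open>Var i\<close>. The truth values 1 and 0 are rendered as \<open>True\<close> and \<open>False\<close>.\<close>

datatype formula =
    Var nat
  | MImp formula formula  (infixr \<open>\<rightharpoonup>\<close> 60)

primrec truth_value :: "(nat \<Rightarrow> bool) \<Rightarrow> formula \<Rightarrow> bool" where
  "truth_value \<nu> (Var i) = \<nu> i"
| "truth_value \<nu> (\<phi> \<rightharpoonup> \<psi>) = (\<not> (truth_value \<nu> \<phi> \<and> truth_value \<nu> \<psi>))"

primrec variables :: "formula \<Rightarrow> nat list" where
  "variables (Var i) = [i]"
| "variables (\<phi> \<rightharpoonup> \<psi>) = variables \<phi> @ variables \<psi>"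

text \<open>Erasing the brackets of a formula leaves its variable occurrences, read from left to
  right and separated by \<open>\<rightharpoonup>\<close>. So the formulae obtained by bracketing
  \<open>p\<^sub>1 \<rightharpoonup> \<dots> \<rightharpoonup> p\<^sub>n\<close> are those whose list of variable occurrences is
  \<open>[1, \<dots>, n]\<close>.\<close>

definition bracketed :: "nat \<Rightarrow> formula set" where
  "bracketed n = {\<phi>. variables \<phi> = [1..<Suc n]}"

text \<open>Extensionality outside \<open>{1..n}\<close> makes each row of a truth table a single function.\<close>

definition valuations :: "nat \<Rightarrow> (nat \<Rightarrow> bool) set" where
  "valuations n = {1..n} \<rightarrow>\<^sub>E UNIV"

definition zero_rows :: "nat \<Rightarrow> nat" where
  "zero_rows n = (\<Sum>\<phi>\<in>bracketed n. card {\<nu> \<in> valuations n. \<not> truth_value \<nu> \<phi>})"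

text \<open>The division is exact for \<open>n \<ge> 1\<close>, see \<open>n_times_catalan\<close> below.\<close>

definition catalan :: "nat \<Rightarrow> nat" where
  "catalan n = ((2 * n - 2) choose (n - 1)) div n"

text \<open>The sum and the cardinalities in \<open>zero_rows\<close> range over finite sets.\<close>

lemma finite_formulae_of_variables: "finite {\<phi>. variables \<phi> = xs}"
proof (induction "length xs" arbitrary: xs rule: less_induct)
  case less
  have nonempty: "variables \<phi> \<noteq> []" for \<phi>
    by (induction \<phi>) auto
  let ?S = "\<lambda>zs. {\<phi>. variables \<phi> = zs}"
  let ?K = "{k. 0 < k \<and> k < length xs}"
  have "?S xs \<subseteq> Var ` set xs \<union>
      (\<Union>k\<in>?K. (\<lambda>(\<phi>, \<psi>). \<phi> \<rightharpoonup> \<psi>) ` (?S (take k xs) \<times> ?S (drop k xs)))"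
  proof
    fix \<phi> assume \<phi>: "\<phi> \<in> ?S xs"
    show "\<phi> \<in> Var ` set xs \<union>
      (\<Union>k\<in>?K. (\<lambda>(\<phi>, \<psi>). \<phi> \<rightharpoonup> \<psi>) ` (?S (take k xs) \<times> ?S (drop k xs)))"
    proof (cases \<phi>)
      case (Var i)
      then show ?thesis using \<phi> by auto
    next
      case (MImp a b)
      then have xs: "xs = variables a @ variables b" using \<phi> by simp
      have "length (variables a) \<in> ?K" using nonempty[of a] nonempty[of b] xs by simp
      moreover have "(a, b) \<in> ?S (take (length (variables a)) xs) \<times> ?S (drop (length (variables a)) xs)"
        using xs by simp
      ultimately show ?thesis using MImp by blast
    qed
  qed
  moreover have "finite (?S (take k xs) \<times> ?S (drop k xs))" if "k \<in> ?K" for k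
    using that by (intro finite_cartesian_product less) auto
  ultimately show ?case
    by (elim finite_subset) auto
qed

lemma finite_bracketed: "finite (bracketed n)"
  unfolding bracketed_def by (rule finite_formulae_of_variables)

lemma finite_valuations: "finite (valuations n)"
  unfolding valuations_def by (intro finite_PiE) auto

lemma n_times_catalan:
  assumes "n \<ge> 1"
  shows "n * catalan n = (2 * n - 2) choose (n - 1)"
proof -
  obtain m where n: "n = Suc m" using assms by (cases n) auto
  have "Suc m * (2 * m choose Suc m) = m * (2 * m choose m)"
    using binomial_absorption[of m "2 * m"] binomial_absorb_comp[of "2 * m" m] by auto
  then have "Suc m dvd m * (2 * m choose m)"
    by (metis dvd_triv_left)
  then have "Suc m dvd (2 * m choose m)"
    using coprime_Suc_left_nat coprime_dvd_mult_right_iff by blast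
  then show ?thesis by (simp add: catalan_def n del: mult_Suc)
qed

end

theory Submission
  imports Defs
begin

text \<open>In a bracketing each variable occurs once, so the rows in which \<open>\<phi> \<rightharpoonup> \<psi>\<close> is false
  are the pairs of a true row of \<open>\<phi>\<close> and a true row of \<open>\<psi>\<close>. As a truth table has an even number
  of rows, induction shows that every bracketing has an odd number of zero rows. Hence \<open>y\<^sub>n\<close> has
  the parity of the number \<open>t\<^sub>n\<close> of bracketings, where
  \<open>t\<^sub>n = \<Sum>0 < k < n. t\<^sub>k t\<^sub>n\<^sub>-\<^sub>k\<close>. Modulo 2 the sum cancels by symmetry except for a possible
  middle term, so \<open>t\<^sub>n\<close> is even for odd \<open>n > 1\<close> and \<open>t\<^sub>2\<^sub>m \<equiv> t\<^sub>m\<close>. The relation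
  \<open>(n + 1) C\<^sub>n\<^sub>+\<^sub>1 = 2 (2n - 1) C\<^sub>n\<close> yields the same two rules for the Catalan numbers.\<close>

section \<open>Parity of the number of zero rows of one formula\<close>

lemma variables_nonempty: "variables \<phi> \<noteq> []"
  by (induction \<phi>) auto

lemma truth_value_cong:
  "(\<And>i. i \<in> set (variables \<phi>) \<Longrightarrow> \<nu> i = \<mu> i) \<Longrightarrow> truth_value \<nu> \<phi> = truth_value \<mu> \<phi>"
  by (induction \<phi>) auto

text \<open>The domain is the formula's own variable set, because subformulae of a bracketing do not
  use an initial segment of the variables.\<close>

definition rows :: "bool \<Rightarrow> formula \<Rightarrow> (nat \<Rightarrow> bool) set" where
  "rows b \<phi> = {\<nu> \<in> set (variables \<phi>) \<rightarrow>\<^sub>E UNIV. truth_value \<nu> \<phi> = b}"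

lemma finite_rows: "finite (rows b \<phi>)"
  unfolding rows_def by (rule finite_subset[of _ "set (variables \<phi>) \<rightarrow>\<^sub>E UNIV"]) (auto intro: finite_PiE)

lemma card_rows_True_False:
  "card (rows True \<phi>) + card (rows False \<phi>) = 2 ^ card (set (variables \<phi>))"
proof -
  have "rows True \<phi> \<union> rows False \<phi> = set (variables \<phi>) \<rightarrow>\<^sub>E UNIV"
    and "rows True \<phi> \<inter> rows False \<phi> = {}"
    by (auto simp: rows_def)
  then have "card (rows True \<phi>) + card (rows False \<phi>)
      = card (set (variables \<phi>) \<rightarrow>\<^sub>E (UNIV :: bool set))"
    by (metis card_Un_disjoint finite_rows)
  then show ?thesis by (simp add: card_PiE)
qed

text \<open>At least one variable occurs, so the exponent in the total
  \<open>2 ^ card (set (variables \<phi>))\<close> is positive.\<close>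

lemma odd_card_rows_iff: "odd (card (rows True \<phi>)) \<longleftrightarrow> odd (card (rows False \<phi>))"
proof -
  have "even (card (rows True \<phi>) + card (rows False \<phi>))"
    by (simp add: card_rows_True_False card_gt_0_iff variables_nonempty)
  then show ?thesis by simp
qed

text \<open>A false row restricts to a true row of each operand; disjointness lets any two such rows
  be glued back together.\<close>

lemma card_rows_False_MImp:
  assumes "set (variables \<phi>) \<inter> set (variables \<psi>) = {}"
  shows "card (rows False (\<phi> \<rightharpoonup> \<psi>)) = card (rows True \<phi>) * card (rows True \<psi>)"
proof -
  let ?A = "set (variables \<phi>)" and ?B = "set (variables \<psi>)"
  let ?split = "\<lambda>\<nu>. (restrict \<nu> ?A, restrict \<nu> ?B)"
  define merge where "merge f g = (\<lambda>i. if i \<in> ?A then f i else g i)" for f g :: "nat \<Rightarrow> bool"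
  let ?merge = "\<lambda>(f, g). merge f g"
  have restrict: "truth_value (restrict \<nu> ?A) \<phi> = truth_value \<nu> \<phi>"
      "truth_value (restrict \<nu> ?B) \<psi> = truth_value \<nu> \<psi>" for \<nu>
    by (rule truth_value_cong; simp)+
  have merge: "truth_value (merge f g) \<phi> = truth_value f \<phi>"
      "truth_value (merge f g) \<psi> = truth_value g \<psi>" for f g
    using assms by (intro truth_value_cong; auto simp: merge_def)+
  have "bij_betw ?split (rows False (\<phi> \<rightharpoonup> \<psi>)) (rows True \<phi> \<times> rows True \<psi>)"
  proof (rule bij_betw_byWitness[where f' = ?merge])
    show "\<forall>\<nu>\<in>rows False (\<phi> \<rightharpoonup> \<psi>). ?merge (?split \<nu>) = \<nu>"
      by (auto simp: merge_def rows_def fun_eq_iff PiE_def extensional_def)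
    show "\<forall>p\<in>rows True \<phi> \<times> rows True \<psi>. ?split (?merge p) = p"
      using assms by (auto simp: merge_def rows_def fun_eq_iff PiE_def extensional_def)
    show "?split ` rows False (\<phi> \<rightharpoonup> \<psi>) \<subseteq> rows True \<phi> \<times> rows True \<psi>"
      by (auto simp: rows_def restrict)
    \<comment> \<open>The first call keeps \<open>merge\<close> folded so that the truth values
      rewrite; the second checks that a merged row is undefined outside both variable sets.\<close>
    show "?merge ` (rows True \<phi> \<times> rows True \<psi>) \<subseteq> rows False (\<phi> \<rightharpoonup> \<psi>)"
      by (auto simp: rows_def merge PiE_def extensional_def) (auto simp: merge_def)
  qed
  then show ?thesis
    by (simp add: bij_betw_same_card card_cartesian_product)
qed

text \<open>The induction hypotheses count false rows, but the product counts true ones;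
  \<open>odd_card_rows_iff\<close> bridges the two.\<close>

lemma odd_card_rows_False: "distinct (variables \<phi>) \<Longrightarrow> odd (card (rows False \<phi>))"
proof (induction \<phi>)
  case (Var i)
  have "rows False (Var i) = {restrict (\<lambda>_. False) {i}}"
    by (auto simp: rows_def fun_eq_iff PiE_def extensional_def)
  then show ?case by simp
next
  case (MImp \<phi> \<psi>)
  then show ?case
    by (simp add: card_rows_False_MImp odd_card_rows_iff)
qed

lemma odd_zero_rows_iff: "odd (zero_rows n) \<longleftrightarrow> odd (card (bracketed n))"
proof -
  have "odd (card {\<nu> \<in> valuations n. \<not> truth_value \<nu> \<phi>})" if "\<phi> \<in> bracketed n" for \<phi>
  proof -
    have "variables \<phi> = [1..<Suc n]"
      using that by (simp add: bracketed_def)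
    moreover from this have "set (variables \<phi>) = {1..n}"
      by (simp add: atLeastLessThanSuc_atLeastAtMost del: upt_Suc)
    ultimately show ?thesis
      using odd_card_rows_False[of \<phi>] by (simp add: rows_def valuations_def)
  qed
  \<comment> \<open>A finite sum has the parity of the number of its odd terms, and here every term
    is odd.\<close>
  then have "{\<phi> \<in> bracketed n. odd (card {\<nu> \<in> valuations n. \<not> truth_value \<nu> \<phi>})} = bracketed n"
    by blast
  then show ?thesis
    by (simp add: zero_rows_def even_sum_iff[OF finite_bracketed])
qed

section \<open>Recursion for the number of bracketings\<close>

text \<open>Arbitrary lists are allowed since the right operand of a bracketing starts at a later
  variable.\<close>

definition bracketings :: "nat list \<Rightarrow> formula set" where
  "bracketings xs = {\<phi>. variables \<phi> = xs}"

lemma bracketings_singleton: "bracketings [x] = {Var x}"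
proof -
  have "\<phi> = Var x" if "variables \<phi> = [x]" for \<phi>
    using that by (cases \<phi>) (auto simp: append_eq_Cons_conv variables_nonempty)
  then show ?thesis by (auto simp: bracketings_def)
qed

text \<open>The outermost connective splits the list into a prefix of length \<open>k\<close> and
  the remaining suffix, both nonempty.\<close>

lemma card_bracketings:
  assumes "length xs > 1"
  shows "card (bracketings xs)
    = (\<Sum>k\<in>{0<..<length xs}. card (bracketings (take k xs)) * card (bracketings (drop k xs)))"
proof -
  let ?P = "\<lambda>k. bracketings (take k xs) \<times> bracketings (drop k xs)"
  let ?f = "\<lambda>(\<phi>, \<psi>). \<phi> \<rightharpoonup> \<psi>"
  have "bracketings xs = (\<Union>k\<in>{0<..<length xs}. ?f ` ?P k)"
  proof
    show "bracketings xs \<subseteq> (\<Union>k\<in>{0<..<length xs}. ?f ` ?P k)"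
    proof
      fix \<chi> assume \<chi>: "\<chi> \<in> bracketings xs"
      then obtain \<phi> \<psi> where eq: "\<chi> = \<phi> \<rightharpoonup> \<psi>"
        using assms by (cases \<chi>) (auto simp: bracketings_def)
      then have xs: "xs = variables \<phi> @ variables \<psi>"
        using \<chi> by (simp add: bracketings_def)
      let ?k = "length (variables \<phi>)"
      have "?k \<in> {0<..<length xs}"
        by (simp add: xs variables_nonempty)
      moreover have "(\<phi>, \<psi>) \<in> ?P ?k"
        by (simp add: xs bracketings_def)
      ultimately show "\<chi> \<in> (\<Union>k\<in>{0<..<length xs}. ?f ` ?P k)"
        unfolding eq by blast
    qed
  qed (auto simp: bracketings_def)
  moreover have "?f ` ?P j \<inter> ?f ` ?P k = {}"
    if "j \<in> {0<..<length xs}" "k \<in> {0<..<length xs}" "j \<noteq> k" for j k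
  proof -
    have "length (take j xs) \<noteq> length (take k xs)"
      using that by simp
    then have "take j xs \<noteq> take k xs"
      by metis
    then show ?thesis by (auto simp: bracketings_def)
  qed
  moreover have "finite (?P k)" for k
    by (simp add: bracketings_def finite_formulae_of_variables)
  ultimately have "card (bracketings xs) = (\<Sum>k\<in>{0<..<length xs}. card (?f ` ?P k))"
    by (simp add: card_UN_disjoint)
  also have "\<dots> = (\<Sum>k\<in>{0<..<length xs}. card (?P k))"
    by (intro sum.cong refl card_image) (auto simp: inj_on_def)
  finally show ?thesis
    by (simp add: card_cartesian_product)
qed

section \<open>Parity of self-convolutions and of Catalan numbers\<close>

text \<open>The reflection of \<open>k\<close> to \<open>n - k\<close> matches \<open>?L\<close>
  with \<open>?R\<close>, which cancel modulo 2; the middle term is a square and has the parity of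
  its root.\<close>

lemma odd_convolution_iff:
  fixes f :: "nat \<Rightarrow> nat"
  assumes "n > 0"
  shows "odd (\<Sum>k\<in>{0<..<n}. f k * f (n - k)) \<longleftrightarrow> even n \<and> odd (f (n div 2))"
proof -
  let ?g = "\<lambda>k. f k * f (n - k)"
  let ?L = "{k. 0 < k \<and> 2 * k < n}" and ?M = "{k. 2 * k = n}" and ?R = "{k. n < 2 * k \<and> k < n}"
  have fin: "finite ?L" "finite ?M" "finite ?R"
    by (rule finite_subset[of _ "{..n}"]; auto)+
  have "{0<..<n} = ?L \<union> ?M \<union> ?R"
    using assms by auto
  moreover have "sum ?g (?L \<union> ?M \<union> ?R) = sum ?g ?L + sum ?g ?M + sum ?g ?R"
    using fin by (subst sum.union_disjoint; (subst sum.union_disjoint)?) auto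
  moreover have "sum ?g ?R = sum ?g ?L"
    by (rule sum.reindex_bij_witness[of _ "\<lambda>k. n - k" "\<lambda>k. n - k"]) auto
  moreover have "?M = (if even n then {n div 2} else {})"
    by auto
  moreover have "even n \<Longrightarrow> n - n div 2 = n div 2"
    by auto
  ultimately show ?thesis
    by auto
qed

lemma catalan_Suc:
  assumes "n \<ge> 1"
  shows "Suc n * catalan (Suc n) = 2 * (2 * n - 1) * catalan n"
proof -
  obtain m where n: "n = Suc m"
    using assms by (cases n) auto
  let ?B = "(2 * m) choose m"
  have "Suc m * ((2 * Suc m) choose Suc m) = Suc m * (2 * (Suc (2 * m) choose m))"
    using Suc_times_binomial[of m "Suc (2 * m)"] by simp
  then have central: "(2 * Suc m) choose Suc m = 2 * (Suc (2 * m) choose m)"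
    by (simp only: mult_cancel1) simp
  have "Suc n * catalan (Suc n) = (2 * n) choose n"
    using n_times_catalan[of "Suc n"] by simp
  then have "Suc n * catalan (Suc n) = 2 * (Suc (2 * m) choose m)"
    unfolding n central .
  \<comment> \<open>The extra factor \<open>n\<close> serves the absorption identity and turns
    \<open>?B\<close> into \<open>n * catalan n\<close>; it is cancelled at the end.\<close>
  then have "n * (Suc n * catalan (Suc n)) = 2 * (Suc m * (Suc (2 * m) choose m))"
    unfolding n by (simp only: ac_simps)
  also have "Suc m * (Suc (2 * m) choose m) = Suc (2 * m) * ?B"
    using binomial_absorb_comp[of "Suc (2 * m)" m] by simp
  also have "Suc (2 * m) = 2 * n - 1"
    by (simp add: n)
  also have "?B = n * catalan n"
    using n_times_catalan[of n] by (simp add: n)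
  finally have "n * (Suc n * catalan (Suc n)) = n * (2 * (2 * n - 1) * catalan n)"
    by (simp only: ac_simps)
  then show ?thesis
    using assms by (simp only: mult_cancel1) simp
qed

lemma even_catalan:
  assumes "odd n" "n > 1"
  shows "even (catalan n)"
proof -
  have "n * catalan n = 2 * (2 * (n - 1) - 1) * catalan (n - 1)"
    using catalan_Suc[of "n - 1"] assms by simp
  then have "even (n * catalan n)"
    by simp
  then show ?thesis
    using assms by simp
qed

text \<open>The odd multipliers express that both numbers have the same 2-adic valuation. Unlike
  mere equality of parities, this survives induction: in passing to \<open>Suc k\<close>, both sides
  gain the same factor 2/(k+1), and all other factors are odd.\<close>

lemma catalan_double:
  assumes "k \<ge> 1"
  shows "\<exists>a b. odd a \<and> odd b \<and> a * catalan (2 * k) = b * catalan k"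
  using assms
proof (induction k rule: nat_induct_at_least)
  case base
  show ?case
    by (rule exI[of _ 1], rule exI[of _ 1]) (simp add: catalan_def)
next
  case (Suc k)
  then obtain a b where ab: "odd a" "odd b" "a * catalan (2 * k) = b * catalan k"
    by blast
  let ?p = "2 * k - 1" and ?q = "(4 * k + 1) * (4 * k - 1)"
  have odds: "odd ?p" "odd ?q"
    using Suc.hyps by auto
  \<comment> \<open>A common factor 2 of the recurrence at \<open>2 * k + 1\<close> has been
    cancelled.\<close>
  have "Suc k * catalan (2 * Suc k) = (4 * k + 1) * catalan (2 * k + 1)"
    using catalan_Suc[of "2 * k + 1"] by simp
  then have "Suc k * ((2 * k + 1) * catalan (2 * Suc k))
      = (4 * k + 1) * ((2 * k + 1) * catalan (2 * k + 1))"
    by (metis mult.left_commute)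
  also have "(2 * k + 1) * catalan (2 * k + 1) = 2 * (4 * k - 1) * catalan (2 * k)"
    using catalan_Suc[of "2 * k"] Suc.hyps by simp
  finally have double: "Suc k * ((2 * k + 1) * catalan (2 * Suc k)) = 2 * ?q * catalan (2 * k)"
    by (simp only: ac_simps)
  have "Suc k * (?p * a * (2 * k + 1) * catalan (2 * Suc k))
      = ?p * a * (Suc k * ((2 * k + 1) * catalan (2 * Suc k)))"
    by (simp only: ac_simps)
  also have "\<dots> = 2 * ?p * ?q * (a * catalan (2 * k))"
    unfolding double by (simp only: ac_simps)
  also have "\<dots> = ?q * b * (2 * ?p * catalan k)"
    unfolding ab(3) by (simp only: ac_simps)
  also have "2 * ?p * catalan k = Suc k * catalan (Suc k)"
    using catalan_Suc[of k] Suc.hyps by simp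
  finally have "Suc k * (?p * a * (2 * k + 1) * catalan (2 * Suc k))
      = Suc k * (?q * b * catalan (Suc k))"
    by (simp only: ac_simps)
  \<comment> \<open>\<open>Suc k\<close> may be even, so it is cancelled rather than absorbed into
    the odd multipliers.\<close>
  then have "?p * a * (2 * k + 1) * catalan (2 * Suc k) = ?q * b * catalan (Suc k)"
    by (simp only: mult_cancel1) simp
  moreover have "odd (?p * a * (2 * k + 1))" "odd (?q * b)"
    using odds ab by auto
  ultimately show ?case by blast
qed

text \<open>This is the rule of \<open>odd_convolution_iff\<close> for \<open>catalan\<close>, so it
  stands in for the convolution recurrence modulo 2.\<close>

lemma odd_catalan_iff:
  assumes "n > 1"
  shows "odd (catalan n) \<longleftrightarrow> even n \<and> odd (catalan (n div 2))"
proof (cases "even n")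
  case True
  then obtain k where k: "n = 2 * k"
    by blast
  then obtain a b where "odd a" "odd b" "a * catalan n = b * catalan k"
    using catalan_double[of k] assms by auto
  then have "odd (catalan n) \<longleftrightarrow> odd (catalan k)"
    by (metis even_mult_iff)
  then show ?thesis by (simp add: k)
next
  case False
  then show ?thesis using even_catalan assms by blast
qed

section \<open>Comparison of bracketings with Catalan numbers modulo 2\<close>

lemma odd_card_bracketings_iff:
  "xs \<noteq> [] \<Longrightarrow> odd (card (bracketings xs)) \<longleftrightarrow> odd (catalan (length xs))"
proof (induction xs rule: length_induct)
  case (1 xs)
  let ?n = "length xs"
  show ?case
  proof (cases "?n > 1")
    case False
    then obtain x where "xs = [x]"
      using 1 by (cases xs) auto
    then show ?thesis
      by (simp add: bracketings_singleton catalan_def)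
  next
    case True
    have IH: "odd (card (bracketings ys)) \<longleftrightarrow> odd (catalan (length ys))"
      if "length ys < ?n" "ys \<noteq> []" for ys
      using 1 that by blast
    have "odd (card (bracketings (take k xs)) * card (bracketings (drop k xs)))
        \<longleftrightarrow> odd (catalan k * catalan (?n - k))" if "k \<in> {0<..<?n}" for k
      using that IH[of "take k xs"] IH[of "drop k xs"] "1.prems" diff_less[of k ?n] by auto
    \<comment> \<open>The two sums have odd terms at the same indices, which fixes their
      parity.\<close>
    then have "{k \<in> {0<..<?n}. odd (card (bracketings (take k xs)) * card (bracketings (drop k xs)))}
        = {k \<in> {0<..<?n}. odd (catalan k * catalan (?n - k))}"
      by blast
    then have "odd (card (bracketings xs)) \<longleftrightarrow> odd (\<Sum>k\<in>{0<..<?n}. catalan k * catalan (?n - k))"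
      unfolding card_bracketings[OF True] by (simp only: even_sum_iff finite_greaterThanLessThan)
    also have "\<dots> \<longleftrightarrow> odd (catalan ?n)"
      using odd_convolution_iff[of ?n catalan] odd_catalan_iff[OF True] "1.prems" by simp
    finally show ?thesis .
  qed
qed

theorem theorem4p2:
  fixes n :: nat
  assumes "n \<ge> 1"
  shows "[zero_rows n = catalan n] (mod 2)"
proof -
  have "odd (card (bracketed n)) \<longleftrightarrow> odd (catalan n)"
    using odd_card_bracketings_iff[of "[1..<Suc n]"] assms
    by (simp add: bracketings_def bracketed_def del: upt_Suc)
  then show ?thesis
    using odd_zero_rows_iff[of n] by (simp add: cong_def mod2_eq_if)
qed

end
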